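(* Let $n$ be a fixed positive integer, and let $t \in \mathrm{PL}^+(S^1)$ be a homeomorphism which maps rational points to rational points, all of whose break points are rational, and all of whose derivatives (on each of its linear pieces) are of the form $n^q$ with $q \in \mathbb{Z}$ ($q$ may depend on the piece). Then the rotation number $\mathrm{rot}(t)$ is rational, i.e. $\mathrm{rot}(t) \in \mathbb{Q}/\mathbb{Z}$.
   Context: Here $S^1 = \mathbb{R}/\mathbb{Z}$, a point of $S^1$ is rational if it lies in $\mathbb{Q}/\mathbb{Z}$, and $\mathrm{PL}^+(S^1)$ denotes the group of orientation-preserving piecewise linear homeomorphisms of $S^1$ (with finitely many linear pieces). A break point is a point at which the derivative is discontinuous. For an orientation-preserving homeomorphism $g$ of $S^1$, let $\tilde g$ be any lift of $g$ to an orientation-preserving homeomorphism of $\mathbb{R}$ and define $\mathrm{rot}(\tilde g) = \lim_{k\to\infty} \tilde g^{k}(0)/k$. The rotation number of $g$ is $\mathrm{rot}(g) = \mathrm{rot}(\tilde g) \pmod{\mathbb{Z}} \in \mathbb{R}/\mathbb{Z}$; it is independent of the choice of lift. *)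

theory Defs
  imports "HOL-Analysis.Analysis"
begin

definition circle_rel :: "real \<Rightarrow> real \<Rightarrow> bool" where
  "circle_rel x y \<longleftrightarrow> x - y \<in> \<int>"

lemma equivp_circle_rel: "equivp circle_rel"
proof (rule equivpI)
  show "reflp circle_rel"
    by (simp add: reflp_def circle_rel_def)
  show "symp circle_rel"
    unfolding symp_def circle_rel_def by (metis Ints_minus minus_diff_eq)
  show "transp circle_rel"
    unfolding transp_def circle_rel_def
    by (metis Ints_add add_diff_eq diff_add_cancel)
qed

quotient_type circle = real / circle_rel
  by (rule equivp_circle_rel)

abbreviation to_circle :: "real \<Rightarrow> circle" where
  "to_circle \<equiv> abs_circle"

lemma to_circle_eq_iff: "to_circle x = to_circle y \<longleftrightarrow> x - y \<in> \<int>"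
  by (metis circle.abs_eq_iff circle_rel_def)

instantiation circle :: topological_space
begin

definition open_circle :: "circle set \<Rightarrow> bool" where
  "open_circle U \<longleftrightarrow> open (to_circle -` U)"

instance
proof
  show "open (UNIV :: circle set)"
    by (simp add: open_circle_def)
next
  fix S T :: "circle set"
  assume "open S" "open T"
  then show "open (S \<inter> T)"
    by (simp add: open_circle_def vimage_Int open_Int)
next
  fix K :: "circle set set"
  assume "\<forall>S\<in>K. open S"
  then show "open (\<Union>K)"
    by (auto simp add: open_circle_def vimage_Union)
qed

end

definition rational_points :: "circle set" where
  "rational_points = to_circle ` \<rat>"

definition is_lift :: "(circle \<Rightarrow> circle) \<Rightarrow> (real \<Rightarrow> real) \<Rightarrow> bool" where
  "is_lift g G \<longleftrightarrow>
     (\<exists>H. homeomorphism UNIV UNIV G H) \<and> strict_mono G \<and>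
     (\<forall>x. to_circle (G x) = g (to_circle x))"

definition orientation_preserving_homeo :: "(circle \<Rightarrow> circle) \<Rightarrow> bool" where
  "orientation_preserving_homeo g \<longleftrightarrow>
     (\<exists>h. homeomorphism UNIV UNIV g h) \<and> (\<exists>G. is_lift g G)"

text \<open>The finite set \<open>B\<close> contains the end points of the linear pieces: \<open>g\<close> is linear on
  every arc that avoids \<open>B\<close>.\<close>

definition piecewise_linear :: "(circle \<Rightarrow> circle) \<Rightarrow> bool" where
  "piecewise_linear g \<longleftrightarrow>
     (\<exists>B. finite B \<and>
        (\<forall>a b. a < b \<and> (\<forall>x\<in>{a<..<b}. to_circle x \<notin> B) \<longrightarrow>
           (\<exists>m c. \<forall>x\<in>{a<..<b}. g (to_circle x) = to_circle (m * x + c))))"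

definition PL_plus :: "(circle \<Rightarrow> circle) set" where
  "PL_plus = {g. orientation_preserving_homeo g \<and> piecewise_linear g}"

text \<open>Two lifts of a circle homeomorphism differ by an integer constant, and a lift commutes with
  \<open>x \<mapsto> x + 1\<close>. Hence derivatives, break points and the rotation number do not depend on the
  choice of the lift or of the representative of \<open>p\<close>.\<close>

definition has_circle_derivative :: "(circle \<Rightarrow> circle) \<Rightarrow> real \<Rightarrow> circle \<Rightarrow> bool" where
  "has_circle_derivative g d p \<longleftrightarrow>
     (\<exists>G x. is_lift g G \<and> to_circle x = p \<and> (G has_real_derivative d) (at x))"

text \<open>A point where the derivative does not exist counts as a discontinuity of the derivative.\<close>

definition break_point :: "(circle \<Rightarrow> circle) \<Rightarrow> circle \<Rightarrow> bool" where
  "break_point g p \<longleftrightarrow>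
     (\<exists>G x. is_lift g G \<and> to_circle x = p \<and>
        \<not> (G differentiable (at x) \<and> isCont (deriv G) x))"

definition rot_lift :: "(real \<Rightarrow> real) \<Rightarrow> real" where
  "rot_lift G = lim (\<lambda>k. (G ^^ k) 0 / real k)"

definition rotation_number :: "(circle \<Rightarrow> circle) \<Rightarrow> circle" where
  "rotation_number g = to_circle (rot_lift (SOME G. is_lift g G))"

end

theory Submission
  imports Defs
begin

text \<open>A circle homeomorphism with a periodic point has rational rotation number, so the proof
  produces a periodic point. Let \<open>G\<close> be a lift of \<open>t\<close>. The break points of \<open>t\<close> are finite in
  number and rational, and each linear piece over \<open>[0, 1]\<close> is \<open>x \<mapsto> n\<^sup>q x + c\<close> with rational \<open>c\<close>. Let \<open>M\<close> clear
  all denominators of break points and constants \<open>c\<close>, and let \<open>K\<close> bound all exponents \<open>q\<close>. Call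
  \<open>[a / (M n\<^sup>k), (a + 1) / (M n\<^sup>k)]\<close> a cell of level \<open>k\<close>. Then \<open>G\<close> maps every cell of level
  \<open>k \<ge> K\<close> affinely onto a single cell, of level \<open>k - q \<ge> 0\<close> (\<open>grid_lift_of_affine_pieces\<close>).
  The case \<open>n = 1\<close> is covered by using base 2, which makes the level of a cell determined by
  its length.

  Call a cell of level \<open>K\<close> good if all its forward images are cells of level at least \<open>K\<close>;
  no iterate ever stretches it. Three observations give the periodic point.

  \<^item> Some cell is good (\<open>ex_good\<close>). Every other cell is eventually stretched onto at least two
    cells of level \<open>K\<close>. If all cells were of this kind, lengths would double again and again
    within bounded time, although every iterate of \<open>G\<close> maps an interval of length 1 onto an
    interval of length 1.

  \<^item> Some image of a good cell lies in a good cell (\<open>good_cell_enters_good_cell\<close>). Among the images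
    under \<open>G\<^sup>i\<close>, \<open>i \<ge> 1\<close>, one has smallest level. The cell of level \<open>K\<close> around it never
    drops below level \<open>K\<close>, because its levels are those of the later images up to a constant
    shift, and the shift puts the minimum at \<open>K\<close>.

  \<^item> Modulo 1 there are only finitely many cells of level \<open>K\<close>. So a chain of good cells, each
    entering the next, returns up to an integer translation: some \<open>G\<^sup>i\<close> followed by an integer
    translation maps a closed interval into itself, and has a fixed point there
    (\<open>ex_periodic_point\<close>).\<close>

section \<open>Lifts of circle homeomorphisms and periodic points\<close>

locale circle_lift =
  fixes G :: "real \<Rightarrow> real"
  assumes cont: "continuous_on UNIV G"
    and mono: "strict_mono G"
    and shift: "G (x + 1) = G x + 1"
begin

lemma shift_int: "G (x + of_int z) = G x + of_int z"
proof (induction z rule: int_induct[where k = 0])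
  case base
  then show ?case by simp
next
  case (step1 i)
  then show ?case using shift[of "x + of_int i"] by (simp add: algebra_simps)
next
  case (step2 i)
  then show ?case using shift[of "x + of_int (i - 1)"] by (simp add: algebra_simps)
qed

lemma iter_shift_int: "(G ^^ m) (x + of_int z) = (G ^^ m) x + of_int z"
  by (induction m) (simp_all add: shift_int)

lemma iter_strict_mono: "strict_mono (G ^^ m)"
  by (induction m) (use mono in \<open>auto simp: strict_mono_def\<close>)

lemma iter_mono: "x \<le> y \<Longrightarrow> (G ^^ m) x \<le> (G ^^ m) y"
  using iter_strict_mono by (simp add: strict_mono_less_eq)

lemma iter_cont: "continuous_on S (G ^^ m)"
proof (induction m)
  case 0
  then show ?case by (simp add: id_def)
next
  case (Suc m)
  then show ?case
    using continuous_on_compose2[OF cont Suc] by (simp add: o_def)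
qed

text \<open>Along the orbit of \<open>x\<close> the displacement from the linear motion with speed \<open>z / I\<close> is periodic
  in time, hence bounded. The orbit of 0 stays within a bounded distance of the orbit of \<open>x\<close>, since
  integer translates of the latter enclose it.\<close>

lemma rot_lift_of_periodic_point:
  assumes "I > 0" and per: "(G ^^ I) x = x + of_int z"
  shows "rot_lift G = of_int z / real I"
proof -
  define d where "d k = (G ^^ k) x - real k * (of_int z / real I)" for k
  have per_k: "(G ^^ (k + I)) x = (G ^^ k) x + of_int z" for k
    unfolding funpow_add o_apply per iter_shift_int ..
  then have "d (k + I) = d k" for k
    unfolding d_def per_k using \<open>I > 0\<close> by (simp add: field_simps)
  then have "d (r + q * I) = d r" for q r
  proof (induction q)
    case (Suc q)
    then show ?case using Suc(2)[of "r + q * I"] by (simp add: algebra_simps)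
  qed simp
  then have d_mod: "d k = d (k mod I)" for k
    by (metis add.commute div_mult_mod_eq)
  define C where "C = Max ((\<lambda>k. \<bar>d k\<bar>) ` {..<I})"
  have d_le: "\<bar>d k\<bar> \<le> C" for k
    unfolding C_def using d_mod[of k] \<open>I > 0\<close> by (intro Max_ge) auto
  define p where "p = \<lceil>\<bar>x\<bar>\<rceil>"
  have near: "\<bar>(G ^^ k) 0 - (G ^^ k) x\<bar> \<le> of_int p" for k
  proof -
    have "x + of_int (- p) \<le> 0" "0 \<le> x + of_int p" unfolding p_def by linarith+
    from this[THEN iter_mono[where m = k]] show ?thesis
      unfolding iter_shift_int by simp
  qed
  have "(\<lambda>k. (G ^^ k) 0 / real k - of_int z / real I) \<longlonglongrightarrow> 0"
  proof (rule Lim_null_comparison)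
    show "\<forall>\<^sub>F k in sequentially. norm ((G ^^ k) 0 / real k - of_int z / real I)
            \<le> (C + of_int p) / real k"
    proof (rule eventually_mono[OF eventually_gt_at_top[of 0]])
      fix k :: nat assume "0 < k"
      have "\<bar>(G ^^ k) 0 - real k * (of_int z / real I)\<bar> \<le> C + of_int p"
        using near[of k] d_le[of k] unfolding d_def by linarith
      moreover have "(G ^^ k) 0 / real k - of_int z / real I
          = ((G ^^ k) 0 - real k * (of_int z / real I)) / real k"
        using \<open>0 < k\<close> by (simp add: field_simps)
      ultimately show "norm ((G ^^ k) 0 / real k - of_int z / real I) \<le> (C + of_int p) / real k"
        using \<open>0 < k\<close> by (simp add: divide_right_mono)
    qed
    show "(\<lambda>k. (C + of_int p) / real k) \<longlonglongrightarrow> 0"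
      by (rule lim_const_over_n)
  qed
  then show ?thesis
    unfolding rot_lift_def by (intro limI) (simp add: LIM_zero_iff)
qed

lemma periodic_point_of_translated_interval:
  assumes "u \<le> v" and "u + of_int z \<le> (G ^^ I) u" and "(G ^^ I) v \<le> v + of_int z"
  shows "\<exists>x. (G ^^ I) x = x + of_int z"
proof -
  have "\<exists>x\<ge>u. x \<le> v \<and> (G ^^ I) x - x = of_int z"
    using assms by (intro IVT2' continuous_intros iter_cont) auto
  then show ?thesis by (auto simp: algebra_simps)
qed

end

section \<open>Affine maps between grid cells\<close>

text \<open>The cell of level \<open>k\<close> and index \<open>a\<close> is \<open>[a / (M n\<^sup>k), (a + 1) / (M n\<^sup>k)]\<close>. The predicate says
  that \<open>f\<close> maps the cell \<open>(k, a)\<close> onto the cell \<open>(l, b)\<close> by the increasing affine bijection. Using the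
  relative position \<open>s\<close> inside a cell as coordinate makes this bijection the identity, so that
  such maps compose and restrict without any bookkeeping of slopes.\<close>

definition maps_cell :: "nat \<Rightarrow> nat \<Rightarrow> (real \<Rightarrow> real) \<Rightarrow> nat \<Rightarrow> int \<Rightarrow> nat \<Rightarrow> int \<Rightarrow> bool" where
  "maps_cell M n f k a l b \<longleftrightarrow>
     (\<forall>s\<in>{0..1}. f ((of_int a + s) / real (M * n ^ k)) = (of_int b + s) / real (M * n ^ l))"

lemma maps_cell_id: "maps_cell M n id k a k a"
  by (simp add: maps_cell_def)

lemma maps_cell_comp:
  "maps_cell M n f k a l b \<Longrightarrow> maps_cell M n g l b m c \<Longrightarrow> maps_cell M n (g \<circ> f) k a m c"
  by (simp add: maps_cell_def)

lemma maps_cell_endpoints: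
  assumes "maps_cell M n f k a l b"
  shows "f (of_int a / real (M * n ^ k)) = of_int b / real (M * n ^ l)"
    and "f ((of_int a + 1) / real (M * n ^ k)) = (of_int b + 1) / real (M * n ^ l)"
  using assms[unfolded maps_cell_def, rule_format, of 0]
    assms[unfolded maps_cell_def, rule_format, of 1] by simp_all

text \<open>An affine map between cells respects the subdivision of each cell into \<open>n\<^sup>d\<close> equal cells.\<close>

lemma maps_cell_subcell:
  assumes "n > 0" and f: "maps_cell M n f k a l b" and r: "0 \<le> r" "r < int (n ^ d)"
  shows "maps_cell M n f (k + d) (a * int (n ^ d) + r) (l + d) (b * int (n ^ d) + r)"
  unfolding maps_cell_def
proof
  fix s :: real assume s: "s \<in> {0..1}"
  define s' where "s' = (of_int r + s) / real (n ^ d)"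
  have "of_int r + 1 \<le> real (n ^ d)" using r by linarith
  \<comment> \<open>\<open>s'\<close> is the position, relative to the large cell, of the point at position \<open>s\<close> in subcell \<open>r\<close>.\<close>
  then have "s' \<in> {0..1}" using s r \<open>n > 0\<close> by (auto simp: s'_def field_simps)
  moreover have "(of_int (c * int (n ^ d) + r) + s) / real (M * n ^ (m + d)) = (of_int c + s') / real (M * n ^ m)"
    for c :: int and m
    using \<open>n > 0\<close> by (cases "M = 0") (simp_all add: s'_def field_simps power_add)
  ultimately show "f ((of_int (a * int (n ^ d) + r) + s) / real (M * n ^ (k + d)))
      = (of_int (b * int (n ^ d) + r) + s) / real (M * n ^ (l + d))"
    using f by (simp add: maps_cell_def)
qed

lemma maps_cell_level_unique:
  assumes "M > 0" "n \<ge> 2" "maps_cell M n f k a l b" "maps_cell M n f k a l' b'"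
  shows "l = l'"
proof -
  have "1 / (real M * real n ^ l) = 1 / (real M * real n ^ l')"
    using maps_cell_endpoints[OF assms(3)] maps_cell_endpoints[OF assms(4)]
    by (simp add: add_divide_distrib)
  then have "real n ^ l = real n ^ l'" using assms(1,2) by (simp add: field_simps)
  then show ?thesis using assms(2) by (simp add: power_inject_exp)
qed

section \<open>A cell that returns into itself\<close>

text \<open>The image of a cell of level \<open>k\<close> under a piece of slope \<open>n\<^sup>q\<close> has level \<open>k - q\<close>. The bound \<open>K\<close>
  keeps this level nonnegative, but the image may well have a level below \<open>K\<close>.\<close>

locale grid_lift = circle_lift +
  fixes M n K :: nat
  assumes M_pos: "M > 0" and n_ge_2: "n \<ge> 2"
    and step: "K \<le> k \<Longrightarrow> \<exists>l b. maps_cell M n G k a l b"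
begin

abbreviation R :: nat where "R \<equiv> M * n ^ K"

lemma R_pos: "R > 0"
  using M_pos n_ge_2 by simp

definition good :: "int \<Rightarrow> bool" where
  "good a \<longleftrightarrow> (\<forall>i. \<exists>k\<ge>K. \<exists>b. maps_cell M n (G ^^ i) K a k b)"

lemma step_iter:
  assumes "maps_cell M n (G ^^ i) k a l b" "K \<le> l"
  shows "\<exists>m c. maps_cell M n (G ^^ Suc i) k a m c"
proof -
  obtain m c where "maps_cell M n G l b m c" using step[OF assms(2)] by blast
  from maps_cell_comp[OF assms(1) this] show ?thesis by auto
qed

text \<open>The first image that is not a cell of level at least \<open>K\<close> is still the image of such a cell
  under \<open>G\<close>, hence a cell, of a level below \<open>K\<close>. It is therefore a union of \<open>n\<^sup>d\<close> cells of
  level \<open>K\<close> with \<open>d \<ge> 1\<close>, and \<open>n\<^sup>d \<ge> 2\<close>.\<close>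

lemma bad_cell_expands:
  assumes "\<not> good a"
  shows "\<exists>i>0. \<exists>A A'. A + 2 \<le> A' \<and> (G ^^ i) (of_int a / R) = of_int A / R
           \<and> (G ^^ i) ((of_int a + 1) / R) = of_int A' / R"
proof -
  define P where "P i \<longleftrightarrow> (\<exists>k\<ge>K. \<exists>b. maps_cell M n (G ^^ i) K a k b)" for i
  have "P 0" unfolding P_def using maps_cell_id[of M n K] by (auto simp: id_def)
  moreover obtain i where "\<not> P i" using assms by (auto simp: good_def P_def)
  ultimately obtain j where j: "P j" "\<not> P (Suc j)"
    by (metis nat_induct)
  then obtain k b where "K \<le> k" "maps_cell M n (G ^^ j) K a k b" by (auto simp: P_def)
  then obtain l c where c: "maps_cell M n (G ^^ Suc j) K a l c" using step_iter by blast
  with j(2) have "l < K" unfolding P_def by (metis not_less)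
  define N where "N = n ^ (K - l)"
  have R: "R = M * n ^ l * N" using \<open>l < K\<close> by (simp add: N_def flip: power_add)
  have "n ^ 1 \<le> N" unfolding N_def using n_ge_2 \<open>l < K\<close> by (intro power_increasing) auto
  then have N: "N \<ge> 2" using n_ge_2 by simp
  have *: "x / real (M * n ^ l) = (x * N) / R" for x :: real
    unfolding R using N by simp
  have "c * int N + 2 \<le> (c + 1) * int N" using N by (simp add: algebra_simps)
  moreover have "(G ^^ Suc j) (of_int a / R) = of_int (c * int N) / R"
    and "(G ^^ Suc j) ((of_int a + 1) / R) = of_int ((c + 1) * int N) / R"
    using maps_cell_endpoints[OF c] unfolding * by simp_all
  ultimately show ?thesis by blast
qed

text \<open>Suppose that every cell of level \<open>K\<close> expands in the sense of \<open>bad_cell_expands\<close>, after at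
  most \<open>T\<close> steps. The length of the image of such a cell under \<open>G\<^sup>m\<close> is then bounded below by
  a constant times \<open>2\<close> to the power \<open>m div T\<close>: after the expansion time, the image contains two cells
  of level \<open>K\<close>, to which the bound for the remaining time applies. But this length is at most 1.\<close>

lemma ex_good: "\<exists>a. good a"
proof (rule ccontr)
  assume "\<not> (\<exists>a. good a)"
  then have "\<forall>a. \<exists>i>0. \<exists>A A'. A + 2 \<le> A' \<and> (G ^^ i) (of_int a / R) = of_int A / R
           \<and> (G ^^ i) ((of_int a + 1) / R) = of_int A' / R"
    using bad_cell_expands by blast
  then obtain i A A' where i: "\<And>a. i a > (0::nat)" and A: "\<And>a. A a + 2 \<le> (A' a :: int)"
    and iA: "\<And>a. (G ^^ i a) (of_int a / R) = of_int (A a) / R"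
      "\<And>a. (G ^^ i a) ((of_int a + 1) / R) = of_int (A' a) / R"
    by metis
  define g where "g m a = (G ^^ m) ((of_int a + 1) / R) - (G ^^ m) (of_int a / R)"
    for m and a :: int
  \<comment> \<open>By periodicity, residues modulo \<open>R\<close> represent all cells; this makes \<open>T\<close> and \<open>\<delta>\<close> extrema of
    finite sets.\<close>
  define T where "T = Max (i ` {0..<int R})"
  define \<delta> where "\<delta> = Min ((\<lambda>(m, a). g m a) ` ({..<T} \<times> {0..<int R}))"
  have i_le: "i a \<le> T" if "0 \<le> a" "a < int R" for a
    unfolding T_def using that by (intro Max_ge) auto
  have T: "T > 0" using i_le[of 0] i[of 0] R_pos by simp
  have g_pos: "g m a > 0" for m a
    using iter_strict_mono[of m] R_pos by (simp add: g_def strict_mono_less divide_strict_right_mono)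
  have ne: "{..<T} \<times> {0..<int R} \<noteq> {}" using T R_pos by auto
  then have \<delta>_pos: "\<delta> > 0"
    unfolding \<delta>_def using g_pos by (subst Min_gr_iff) auto
  have \<delta>_le: "\<delta> \<le> g m a" if "m < T" "0 \<le> a" "a < int R" for m a
    unfolding \<delta>_def using that by (intro Min_le) auto
  have g_mod: "g m a = g m (a mod int R)" for m a
  proof -
    have "real_of_int a = of_int (a mod int R) + real R * of_int (a div int R)"
      by (metis mod_mult_div_eq of_int_add of_int_mult of_int_of_nat_eq)
    then have e: "(real_of_int a + c) / R = (of_int (a mod int R) + c) / R + of_int (a div int R)"
      for c
      using R_pos by (simp add: field_simps)
    show ?thesis
      unfolding g_def using e[of 0] e[of 1] by (simp add: iter_shift_int)
  qed
  have growth: "2 ^ (m div T) * \<delta> \<le> g m a" for m a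
  proof (induction m arbitrary: a rule: less_induct)
    case (less m)
    define r where "r = a mod int R"
    have r: "0 \<le> r" "r < int R" using R_pos by (simp_all add: r_def del: of_nat_mult)
    show ?case
    proof (cases "m < T")
      case True
      then show ?thesis using \<delta>_le r g_mod[of m a] by (simp add: r_def)
    next
      case False
      define j where "j = m - i r"
      have ir: "i r \<le> T" "i r > 0" using i_le r i by auto
      have m: "m = j + i r" and "j < m" using ir False by (auto simp: j_def)
      have "m div T \<le> Suc (j div T)"
        using ir T div_le_mono[of m "j + T" T] m by simp
      then have "2 ^ (m div T) * \<delta> \<le> 2 * (2 ^ (j div T) * \<delta>)"
        using \<delta>_pos power_increasing[of "m div T" "Suc (j div T)" "2::real"] by simp
      also have "\<dots> \<le> g j (A r) + g j (A r + 1)"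
        using less[OF \<open>j < m\<close>, of "A r"] less[OF \<open>j < m\<close>, of "A r + 1"] by simp
      also have "\<dots> = (G ^^ j) (of_int (A r + 2) / R) - (G ^^ j) (of_int (A r) / R)"
        by (simp add: g_def add.assoc)
      also have "\<dots> \<le> (G ^^ j) (of_int (A' r) / R) - (G ^^ j) (of_int (A r) / R)"
        using A[of r] by (intro diff_right_mono iter_mono divide_right_mono) auto
      also have "\<dots> = g m r"
        unfolding g_def m funpow_add o_apply iA ..
      also have "\<dots> = g m a" using g_mod[of m a] by (simp add: r_def)
      finally show ?thesis .
    qed
  qed
  obtain p where p: "1 / \<delta> < 2 ^ p"
    using real_arch_pow[of 2 "1 / \<delta>"] by auto
  have "1 / real R \<le> 1"
  proof (rule divide_le_eq_1_pos[THEN iffD2])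
    show "0 < real R" "1 \<le> real R" using R_pos by linarith+
  qed
  then have "g (T * p) 0 \<le> (G ^^ (T * p)) (0 + of_int 1) - (G ^^ (T * p)) 0"
    unfolding g_def using iter_mono[of "1 / R" 1 "T * p"] by simp
  also have "\<dots> = 1" unfolding iter_shift_int by simp
  finally have "2 ^ p * \<delta> \<le> 1" using growth[of "T * p" 0] T by simp
  then show False using p \<delta>_pos by (simp add: field_simps)
qed

text \<open>Let \<open>k i\<close> be the level of the image of \<open>a\<close> under \<open>G\<^sup>i\<close>, and choose \<open>i \<ge> 1\<close> with \<open>k i\<close> minimal.
  The cell \<open>a'\<close> is the one of level \<open>K\<close> that contains this image. As long as \<open>G\<^sup>j\<close> is affine on \<open>a'\<close>
  with image of level \<open>l\<close>, it sends the subcell to level \<open>l + (k i - K)\<close>, and this is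
  \<open>k (j + i) \<ge> k i\<close>. Hence \<open>l \<ge> K\<close>, and the next step is affine on \<open>a'\<close> too.\<close>

lemma good_cell_enters_good_cell:
  assumes "good a"
  shows "\<exists>i>0. \<exists>a'. good a' \<and> of_int a' / R \<le> (G ^^ i) (of_int a / R)
           \<and> (G ^^ i) ((of_int a + 1) / R) \<le> (of_int a' + 1) / R"
proof -
  obtain k b where k: "\<And>i. k i \<ge> K" and b: "\<And>i. maps_cell M n (G ^^ i) K a (k i) (b i)"
    using assms unfolding good_def by metis
  obtain i where "i > 0" and least: "\<And>j. j > 0 \<Longrightarrow> k i \<le> k j"
    using ex_has_least_nat[of "\<lambda>i. i > 0" 1 k] by auto
  define d where "d = k i - K"
  define a' where "a' = b i div int (n ^ d)"
  define r where "r = b i mod int (n ^ d)"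
  have ki: "k i = K + d" using k[of i] by (simp add: d_def)
  have bi: "b i = a' * int (n ^ d) + r" unfolding a'_def r_def by (rule div_mult_mod_eq[symmetric])
  have nd: "int (n ^ d) > 0" using n_ge_2 by simp
  then have r: "0 \<le> r" "r < int (n ^ d)" by (simp_all add: r_def)
  have "good a'"
    unfolding good_def
  proof
    fix j show "\<exists>l\<ge>K. \<exists>c. maps_cell M n (G ^^ j) K a' l c"
    proof (induction j)
      case 0
      then show ?case using maps_cell_id[of M n K] by (auto simp: id_def)
    next
      case (Suc j)
      then obtain l c where c: "maps_cell M n (G ^^ Suc j) K a' l c"
        using step_iter by blast
      have "maps_cell M n (G ^^ Suc j) (k i) (b i) (l + d) (c * int (n ^ d) + r)"
        unfolding ki bi using n_ge_2 by (intro maps_cell_subcell c r) auto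
      from maps_cell_comp[OF b this]
      have "maps_cell M n (G ^^ (Suc j + i)) K a (l + d) (c * int (n ^ d) + r)"
        by (simp only: funpow_add)
      from maps_cell_level_unique[OF M_pos n_ge_2 this b]
      have "l + d = k (Suc j + i)" .
      then have "K \<le> l" using least[of "Suc j + i"] ki by simp
      then show ?case using c by blast
    qed
  qed
  moreover have "of_int a' / R \<le> (G ^^ i) (of_int a / R)"
    and "(G ^^ i) ((of_int a + 1) / R) \<le> (of_int a' + 1) / R"
  proof -
    have e: "x / real (M * n ^ k i) = (x / real (n ^ d)) / R" for x
      by (simp add: ki power_add)
    have "of_int r + 1 \<le> real (n ^ d)" using r by linarith
    then have "of_int a' \<le> of_int (b i) / real (n ^ d)"
      "(of_int (b i) + 1) / real (n ^ d) \<le> of_int a' + 1"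
      unfolding bi using r nd by (simp_all add: field_simps)
    then show "of_int a' / R \<le> (G ^^ i) (of_int a / R)"
      "(G ^^ i) ((of_int a + 1) / R) \<le> (of_int a' + 1) / R"
      by (simp_all only: maps_cell_endpoints[OF b[of i]] e divide_right_mono of_nat_0_le_iff)
  qed
  ultimately show ?thesis using \<open>i > 0\<close> by blast
qed

text \<open>For images of cells inside cells it suffices to compare end points, as iterates of \<open>G\<close> are
  increasing. Cells with indices congruent modulo \<open>R\<close> are integer translates of each other.\<close>

lemma ex_periodic_point: "\<exists>I>0. \<exists>x z. (G ^^ I) x = x + of_int z"
proof -
  define enters where "enters i a a' \<longleftrightarrow> of_int a' / R \<le> (G ^^ i) (of_int a / R)
           \<and> (G ^^ i) ((of_int a + 1) / R) \<le> (of_int a' + 1) / R" for i a a'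
  have enters_trans: "enters (j + i) a a''" if "enters i a a'" "enters j a' a''" for i j a a' a''
    using that order_trans[OF _ iter_mono[where m = j]] order_trans[OF iter_mono[where m = j]]
    unfolding enters_def funpow_add o_apply by blast
  obtain a0 where a0: "good a0" using ex_good by blast
  obtain \<tau> \<phi> where \<tau>: "\<And>a. good a \<Longrightarrow> \<tau> a > (0::nat)"
    and \<phi>: "\<And>a. good a \<Longrightarrow> good (\<phi> a)" "\<And>a. good a \<Longrightarrow> enters (\<tau> a) a (\<phi> a)"
    using good_cell_enters_good_cell unfolding enters_def by metis
  define c where "c s = (\<phi> ^^ s) a0" for s
  have c_good: "good (c s)" for s
    by (induction s) (use a0 \<phi> in \<open>auto simp: c_def\<close>)
  have chain: "\<exists>i>0. enters i (c s) (c (Suc s + m))" for s m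
  proof (induction m)
    case 0
    then show ?case using \<tau>[OF c_good[of s]] \<phi>(2)[OF c_good[of s]] by (auto simp: c_def)
  next
    case (Suc m)
    then obtain i where "i > 0" "enters i (c s) (c (Suc s + m))" by blast
    moreover have "enters (\<tau> (c (Suc s + m))) (c (Suc s + m)) (c (Suc s + Suc m))"
      using \<phi>(2)[OF c_good[of "Suc s + m"]] by (simp add: c_def)
    ultimately show ?case using enters_trans by (meson add_pos_nonneg trans_less_add2)
  qed
  have "finite (range (\<lambda>s. c s mod int R))"
    by (rule finite_subset[of _ "{0..<int R}"]) (use R_pos in \<open>auto simp del: of_nat_mult\<close>)
  then have "\<not> inj (\<lambda>s. c s mod int R)"
    using finite_imageD infinite_UNIV_nat by blast
  then obtain s u where "s < u" and su: "c s mod int R = c u mod int R"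
    unfolding inj_def by (metis nat_neq_iff)
  obtain i where "i > 0" and i: "enters i (c s) (c u)"
    using chain[of s "u - Suc s"] \<open>s < u\<close> by auto
  from su obtain z where z: "c u = c s + int R * z"
    by (metis mod_eqE)
  have "real_of_int (c u) = of_int (c s) + real R * of_int z"
    unfolding z by simp
  then have "(of_int (c u) + e) / R = (of_int (c s) + e) / R + of_int z" for e
    using R_pos by (simp add: field_simps)
  from this[of 0] this[of 1] have "\<exists>x. (G ^^ i) x = x + of_int z"
    using i unfolding enters_def
    by (intro periodic_point_of_translated_interval[of "of_int (c s) / R" "(of_int (c s) + 1) / R"])
       (simp_all add: divide_right_mono)
  then show ?thesis using \<open>i > 0\<close> by blast
qed

end

section \<open>From the circle to the grid\<close>

lemma common_denominator:
  assumes "finite S" "S \<subseteq> \<rat>"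
  shows "\<exists>N>0. \<forall>x\<in>S. real N * x \<in> \<int>"
  using assms
proof (induction S)
  case empty
  then show ?case by auto
next
  case (insert x S)
  then obtain N where N: "N > 0" "\<forall>y\<in>S. real N * y \<in> \<int>" by auto
  obtain p q where "q > 0" and x: "x = of_int p / of_int q"
    using insert.prems by (auto elim: Rats_cases')
  then have "real (nat q) * x = of_int p" by simp
  then have "real (N * nat q) * x = of_int (int N * p)" by (simp add: mult.assoc)
  then have "real (N * nat q) * x \<in> \<int>" by (metis Ints_of_int)
  moreover have "real (N * nat q) * y \<in> \<int>" if "y \<in> S" for y
  proof -
    have "real (N * nat q) * y = real (nat q) * (real N * y)" by simp
    then show ?thesis using N that by (metis Ints_mult Ints_of_nat)
  qed
  ultimately show ?case using N(1) \<open>q > 0\<close> by (intro exI[of _ "N * nat q"]) auto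
qed

lemma continuous_countable_range_constant:
  fixes f :: "'a::topological_space \<Rightarrow> 'b::metric_space"
  assumes "connected S" "continuous_on S f" "countable (f ` S)" "x \<in> S" "y \<in> S"
  shows "f x = f y"
  using connected_uncountable[OF connected_continuous_image[OF assms(2,1)]] assms(3-) by blast

text \<open>The increment \<open>G (x + 1) - G x\<close> is a positive integer. If it were at least 2, the intermediate
  value theorem would give a point strictly between \<open>x\<close> and \<open>x + 1\<close> with the same image on the
  circle as \<open>x\<close>.\<close>

lemma circle_lift_of_is_lift:
  assumes lift: "is_lift g G" and "inj g"
  shows "circle_lift G"
proof
  obtain H where H: "homeomorphism UNIV UNIV G H" and mono: "strict_mono G"
    and G: "\<And>x. to_circle (G x) = g (to_circle x)"
    using lift by (auto simp: is_lift_def)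
  show cont: "continuous_on UNIV G" using H by (simp add: homeomorphism_def)
  show "strict_mono G" by fact
  show "G (x + 1) = G x + 1" for x
  proof -
    have "to_circle (G (x + 1)) = to_circle (G x)"
      unfolding G by (metis G Ints_1 add_diff_cancel_left' to_circle_eq_iff)
    then obtain d where d: "G (x + 1) - G x = of_int d"
      by (auto simp: to_circle_eq_iff elim: Ints_cases)
    have "G x < G (x + 1)" using mono by (simp add: strict_mono_less)
    then have "d \<ge> 1" using d by linarith
    moreover have "\<not> d \<ge> 2"
    proof
      assume "d \<ge> 2"
      then have "G x + 1 \<le> G (x + 1)" using d by linarith
      then obtain y where y: "x \<le> y" "y \<le> x + 1" "G y = G x + 1"
        using IVT'[of G x "G x + 1" "x + 1"] cont continuous_on_subset by fastforce
      have "to_circle (G y) = to_circle (G x)" using y by (simp add: to_circle_eq_iff)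
      then have "to_circle y = to_circle x" using G \<open>inj g\<close> by (simp add: inj_eq)
      then obtain e where e: "y = x + of_int e"
        by (auto simp: to_circle_eq_iff algebra_simps elim!: Ints_cases)
      have "y \<noteq> x" using y by auto
      moreover have "y \<noteq> x + 1" using y d \<open>d \<ge> 2\<close> by auto
      ultimately show False using e y by (smt (verit) of_int_1 of_int_le_iff of_int_0 of_int_less_iff)
    qed
    ultimately show ?thesis using d by simp
  qed
qed

text \<open>On an interval that avoids the exceptional set \<open>B\<close> of \<open>g\<close>, the lift differs from an affine
  function by a continuous integer-valued function, that is, by a constant. So break points lie
  over \<open>B\<close>, which has finitely many preimages in a bounded interval.\<close>

lemma finite_break_points:
  assumes lift: "is_lift g G" and "piecewise_linear g"
  shows "finite {x \<in> {0..1}. \<not> (G differentiable (at x) \<and> isCont (deriv G) x)}"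
proof -
  obtain B where "finite B" and B: "\<And>a b. a < b \<Longrightarrow> \<forall>x\<in>{a<..<b}. to_circle x \<notin> B \<Longrightarrow>
      \<exists>m c. \<forall>x\<in>{a<..<b}. g (to_circle x) = to_circle (m * x + c)"
    using \<open>piecewise_linear g\<close> by (auto simp: piecewise_linear_def)
  have cont: "continuous_on S G" for S
    using lift continuous_on_subset by (auto simp: is_lift_def homeomorphism_def)
  have G: "to_circle (G x) = g (to_circle x)" for x using lift by (simp add: is_lift_def)
  \<comment> \<open>The margin around \<open>{0..1}\<close> leaves room for neighbourhoods of radius 1 of points in \<open>{0..1}\<close>.\<close>
  define F where "F = {x \<in> {-1..2}. to_circle x \<in> B}"
  have "finite {x \<in> {-1..2}. to_circle x = p}" for p
  proof (cases "\<exists>y. to_circle y = p")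
    case True
    then obtain y where y: "to_circle y = p" by blast
    have "{x \<in> {-1..2}. to_circle x = p} \<subseteq> (\<lambda>z. y + of_int z) ` {\<lfloor>-1 - y\<rfloor>..\<lceil>2 - y\<rceil>}"
    proof
      fix x assume "x \<in> {x \<in> {-1..2}. to_circle x = p}"
      then obtain z where z: "x = y + of_int z" and x: "-1 \<le> x" "x \<le> 2"
        using y by (auto simp: to_circle_eq_iff algebra_simps elim!: Ints_cases)
      have "z \<in> {\<lfloor>-1 - y\<rfloor>..\<lceil>2 - y\<rceil>}" using x unfolding z by (simp, linarith)
      then show "x \<in> (\<lambda>z. y + of_int z) ` {\<lfloor>-1 - y\<rfloor>..\<lceil>2 - y\<rceil>}" using z by blast
    qed
    then show ?thesis by (rule finite_subset) simp
  next
    case False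
    then show ?thesis by auto
  qed
  moreover have "F = (\<Union>p\<in>B. {x \<in> {-1..2}. to_circle x = p})" by (auto simp: F_def)
  ultimately have "finite F" using \<open>finite B\<close> by auto
  have "G differentiable (at x) \<and> isCont (deriv G) x" if x: "x \<in> {0..1}" "x \<notin> F" for x
  proof -
    obtain e where "e > 0" and e: "\<forall>y\<in>F. y \<noteq> x \<longrightarrow> e \<le> dist x y"
      using finite_set_avoid[OF \<open>finite F\<close>] by blast
    define a b where "a = x - min e 1" and "b = x + min e 1"
    have ab: "a < b" "x \<in> {a<..<b}" using \<open>e > 0\<close> by (auto simp: a_def b_def)
    have "\<forall>y\<in>{a<..<b}. to_circle y \<notin> B"
    proof (intro ballI notI)
      fix y assume y: "y \<in> {a<..<b}" "to_circle y \<in> B"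
      then have "y \<in> F" using x by (auto simp: F_def a_def b_def)
      then have "e \<le> dist x y" using e x by auto
      then show False using y by (auto simp: a_def b_def dist_real_def)
    qed
    from B[OF ab(1) this] obtain m c where
      mc: "\<And>y. y \<in> {a<..<b} \<Longrightarrow> g (to_circle y) = to_circle (m * y + c)" by blast
    define u where "u y = G y - (m * y + c)" for y
    have Z: "u y \<in> \<int>" if "y \<in> {a<..<b}" for y
      using mc[OF that] unfolding G[symmetric] u_def by (simp add: to_circle_eq_iff)
    have "u y = u x" if "y \<in> {a<..<b}" for y
    proof (rule continuous_countable_range_constant[where S = "{a<..<b}" and f = u])
      show "continuous_on {a<..<b} u" unfolding u_def by (intro continuous_intros cont)
      show "countable (u ` {a<..<b})"
        using Z by (intro countable_subset[OF _ countable_int]) auto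
    qed (use that ab in auto)
    then have aff: "G y = m * y + (c + u x)" if "y \<in> {a<..<b}" for y
      using that by (fastforce simp: u_def)
    have D: "(G has_real_derivative m) (at y)" if "y \<in> {a<..<b}" for y
    proof (rule has_field_derivative_transform_within_open[where S = "{a<..<b}"])
      show "((\<lambda>y. m * y + (c + u x)) has_real_derivative m) (at y)"
        by (auto intro!: derivative_eq_intros)
    qed (use that aff in auto)
    have "continuous_on {a<..<b} (deriv G)"
      using DERIV_imp_deriv[OF D] by (subst continuous_on_cong[where g = "\<lambda>_. m"]) auto
    then have "isCont (deriv G) x" using ab by (simp add: continuous_on_eq_continuous_at)
    then show ?thesis using D[OF ab(2)] by (auto simp: real_differentiable_def)
  qed
  then have "{x \<in> {0..1}. \<not> (G differentiable (at x) \<and> isCont (deriv G) x)} \<subseteq> F" by auto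
  then show ?thesis using \<open>finite F\<close> finite_subset by blast
qed

text \<open>Away from break points the derivative is continuous. With values in a countable set, such as
  the powers of \<open>n\<close>, it must be constant on an interval.\<close>

lemma affine_on_break_free_interval:
  assumes "u < v" and cont: "continuous_on {u..v} G" and "countable D"
    and smooth: "\<And>x. x \<in> {u<..<v} \<Longrightarrow> G differentiable (at x) \<and> isCont (deriv G) x"
    and D: "\<And>x d. (G has_real_derivative d) (at x) \<Longrightarrow> d \<in> D"
  shows "\<exists>d\<in>D. \<forall>x\<in>{u..v}. G x = d * (x - u) + G u"
proof -
  define w where "w = (u + v) / 2"
  have w: "w \<in> {u<..<v}" using \<open>u < v\<close> by (auto simp: w_def)
  have der: "(G has_real_derivative deriv G x) (at x)" if "x \<in> {u<..<v}" for x
    using smooth[OF that] by (metis DERIV_imp_deriv real_differentiable_def)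
  have const: "deriv G x = deriv G w" if "x \<in> {u<..<v}" for x
  proof (rule continuous_countable_range_constant[where S = "{u<..<v}" and f = "deriv G"])
    show "continuous_on {u<..<v} (deriv G)"
      using smooth by (simp add: continuous_at_imp_continuous_on)
    show "countable (deriv G ` {u<..<v})"
      using D[OF der] by (intro countable_subset[OF _ \<open>countable D\<close>]) auto
  qed (use that w in auto)
  have "G x - deriv G w * x = G u - deriv G w * u" if "x \<in> {u..v}" for x
  proof (rule DERIV_isconst2[OF \<open>u < v\<close>, where f = "\<lambda>x. G x - deriv G w * x"])
    show "continuous_on {u..v} (\<lambda>x. G x - deriv G w * x)" by (intro continuous_intros cont)
    fix y assume "u < y" "y < v"
    then have "(G has_real_derivative deriv G w) (at y)" using der[of y] const[of y] by simp
    then show "((\<lambda>x. G x - deriv G w * x) has_real_derivative 0) (at y)"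
      by (auto intro!: derivative_eq_intros)
  qed (use that in auto)
  then show ?thesis using D[OF der[OF w]] by (intro bexI[of _ "deriv G w"]) (auto simp: algebra_simps)
qed

text \<open>Let \<open>L\<close> clear the denominators of the constant terms \<open>c j\<close> of the pieces. With \<open>M = N L\<close>,
  a cell of level \<open>k\<close> lies, up to an integer translation \<open>z\<close>, in one of the pieces
  \<open>[j / N, (j + 1) / N]\<close>. Since \<open>q j \<le> K \<le> k\<close>, the constant \<open>c j\<close> is a grid point of level
  \<open>k - q j \<ge> 0\<close>, and \<open>x \<mapsto> n\<^sup>q x + c\<close> sends the cell to a cell of that level.\<close>

lemma grid_lift_of_affine_pieces:
  assumes "circle_lift G" and "n \<ge> 2" and "N > 0"
    and aff: "\<And>j. j < N \<Longrightarrow> \<exists>q::int. \<forall>x\<in>{real j / N..(real j + 1) / N}.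
                G x = real n powi q * (x - real j / N) + G (real j / N)"
    and rat: "\<And>x. x \<in> \<rat> \<Longrightarrow> G x \<in> \<rat>"
  shows "\<exists>M K. grid_lift G M n K"
proof -
  interpret circle_lift G by fact
  obtain q :: "nat \<Rightarrow> int" where q: "\<And>j x. j < N \<Longrightarrow> x \<in> {real j / N..(real j + 1) / N} \<Longrightarrow>
      G x = real n powi q j * (x - real j / N) + G (real j / N)"
    using aff by metis
  define c where "c j = G (real j / N) - real n powi q j * (real j / N)" for j
  have "real n powi p \<in> \<rat>" for p
    by (auto simp: power_int_def)
  then have "c ` {..<N} \<subseteq> \<rat>" by (auto simp: c_def intro!: Rats_diff Rats_mult Rats_divide rat)
  from common_denominator[OF _ this] obtain L where "L > 0"
    and L: "\<And>j. j < N \<Longrightarrow> real L * c j \<in> \<int>" by auto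
  define K where "K = Max ((\<lambda>j. nat \<bar>q j\<bar>) ` {..<N})"
  have K: "q j \<le> int K" if "j < N" for j
  proof -
    have "nat \<bar>q j\<bar> \<le> K" unfolding K_def using that by (intro Max_ge) auto
    then show ?thesis by linarith
  qed
  have n0: "real n \<noteq> 0" using \<open>n \<ge> 2\<close> by simp
  have "grid_lift G (N * L) n K"
  proof
    show "N * L > 0" "n \<ge> 2" using \<open>N > 0\<close> \<open>L > 0\<close> \<open>n \<ge> 2\<close> by auto
    fix k a assume "K \<le> k"
    \<comment> \<open>Each interval between consecutive multiples of \<open>1 / N\<close> consists of \<open>P\<close> cells of level \<open>k\<close>;
      \<open>e\<close> is the index of the interval that contains the cell \<open>a\<close>.\<close>
    define P where "P = int (L * n ^ k)"
    define e where "e = a div P"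
    define j where "j = nat (e mod int N)"
    define z where "z = e div int N"
    have P: "P > 0" using \<open>L > 0\<close> \<open>n \<ge> 2\<close> by (simp add: P_def)
    have "j < N" and e: "e = z * int N + int j" using \<open>N > 0\<close> by (auto simp: j_def z_def nat_less_iff)
    have a: "a = e * P + a mod P" by (simp add: e_def)
    have am: "0 \<le> a mod P" "a mod P < P" using P by auto
    define l where "l = nat (int k - q j)"
    have l: "int l = int k - q j" using K[OF \<open>j < N\<close>] \<open>K \<le> k\<close> by (simp add: l_def)
    have nl: "real n powi q j * real n ^ l = real n ^ k"
    proof -
      have "real n powi q j * real n ^ l = real n powi (q j + int l)"
        using n0 by (simp add: power_int_add)
      then show ?thesis using l by simp
    qed
    obtain m where m: "real L * c j = of_int m" using L[OF \<open>j < N\<close>] by (auto elim: Ints_cases)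
    define b where "b = a - z * (int N * P) + int N * m * int n ^ l + z * (int (N * L) * int n ^ l)"
    have "maps_cell (N * L) n G k a l b"
      unfolding maps_cell_def
    proof
      fix s :: real assume s: "s \<in> {0..1}"
      define y where "y = (of_int a + s) / (real N * of_int P) - of_int z"
      have NP: "real (N * L * n ^ k) = real N * of_int P" by (simp add: P_def)
      have y: "y = (real j + (of_int (a mod P) + s) / of_int P) / N"
      proof -
        have "real_of_int a = (of_int z * N + j) * of_int P + of_int (a mod P)"
          using arg_cong[OF a, of real_of_int] unfolding e by simp
        then show ?thesis unfolding y_def using P \<open>N > 0\<close> by (simp add: field_simps)
      qed
      have "of_int (a mod P) + 1 \<le> real_of_int P" using am by linarith
      then have "of_int (a mod P) + s \<le> real_of_int P" using s by simp
      then have "0 \<le> (of_int (a mod P) + s) / of_int P" "(of_int (a mod P) + s) / of_int P \<le> 1"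
        using am s P by simp_all
      then have "y \<in> {real j / N..(real j + 1) / N}"
        unfolding y by (auto intro!: divide_right_mono)
      from q[OF \<open>j < N\<close> this] have Gy: "G y = real n powi q j * y + c j"
        by (simp add: c_def algebra_simps)
      have "G ((of_int a + s) / real (N * L * n ^ k)) = G (y + of_int z)"
        unfolding NP y_def by simp
      also have "\<dots> = real n powi q j * y + c j + of_int z" by (simp add: shift_int Gy)
      also have "\<dots> = (of_int b + s) / real (N * L * n ^ l)"
      proof -
        have "real n powi q j * y * (N * L * n ^ l) = y * (real N * of_int P)"
          using nl by (simp add: P_def)
        also have "\<dots> = of_int a + s - of_int z * (real N * of_int P)"
          unfolding y_def using P \<open>N > 0\<close> by (simp add: field_simps)
        finally have "real n powi q j * y * (N * L * n ^ l)
            = of_int a + s - of_int z * (real N * of_int P)" .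
        moreover have "c j * (N * L * n ^ l) = of_int m * (real N * real n ^ l)"
          unfolding m[symmetric] by simp
        ultimately have "(real n powi q j * y + c j + of_int z) * (N * L * n ^ l) = of_int b + s"
          unfolding distrib_right by (simp add: b_def)
        then show ?thesis using \<open>N > 0\<close> \<open>L > 0\<close> n0 by (simp add: eq_divide_eq)
      qed
      finally show "G ((of_int a + s) / real (N * L * n ^ k)) = (of_int b + s) / real (N * L * n ^ l)"
        by simp
    qed
    then show "\<exists>l b. maps_cell (N * L) n G k a l b" by blast
  qed
  then show ?thesis by blast
qed

lemma rational_points_iff: "to_circle x \<in> rational_points \<longleftrightarrow> x \<in> \<rat>"
proof
  assume "to_circle x \<in> rational_points"
  then obtain y where y: "y \<in> \<rat>" "x - y \<in> \<int>"
    by (auto simp: rational_points_def to_circle_eq_iff)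
  then have "(x - y) + y \<in> \<rat>" using Ints_subset_Rats by (intro Rats_add) auto
  then show "x \<in> \<rat>" by simp
qed (auto simp: rational_points_def)

text \<open>If \<open>N\<close> is a common denominator of the break points in \<open>{0..1}\<close>, the open intervals between
  consecutive multiples of \<open>1 / N\<close> contain no break point, so \<open>G\<close> is affine on their closures.\<close>

lemma rot_lift_rational:
  assumes "n \<ge> 2" and lift: "is_lift t G" and "t \<in> PL_plus"
    and rat: "\<And>p. p \<in> rational_points \<Longrightarrow> t p \<in> rational_points"
    and brk: "\<And>p. break_point t p \<Longrightarrow> p \<in> rational_points"
    and der: "\<And>p d. has_circle_derivative t d p \<Longrightarrow> \<exists>q::int. d = real n powi q"
  shows "rot_lift G \<in> \<rat>"
proof -
  have "inj t" using \<open>t \<in> PL_plus\<close>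
    by (auto simp: PL_plus_def orientation_preserving_homeo_def homeomorphism_def intro: inj_on_inverseI)
  then have "circle_lift G" by (rule circle_lift_of_is_lift[OF lift])
  then interpret circle_lift G .
  define S where "S = {x \<in> {0..1}. \<not> (G differentiable (at x) \<and> isCont (deriv G) x)}"
  have "finite S" unfolding S_def using \<open>t \<in> PL_plus\<close>
    by (intro finite_break_points[OF lift]) (simp add: PL_plus_def)
  moreover have "S \<subseteq> \<rat>"
  proof
    fix x assume "x \<in> S"
    then have "break_point t (to_circle x)"
      using lift unfolding S_def break_point_def by blast
    then show "x \<in> \<rat>" using brk rational_points_iff by blast
  qed
  ultimately have "\<exists>N>0. \<forall>x\<in>S. real N * x \<in> \<int>"
    by (rule common_denominator)
  then obtain N where "N > 0" and N: "\<And>x. x \<in> S \<Longrightarrow> real N * x \<in> \<int>"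
    by blast
  have "\<exists>q::int. \<forall>x\<in>{real j / N..(real j + 1) / N}.
      G x = real n powi q * (x - real j / N) + G (real j / N)" if "j < N" for j
  proof -
    have "\<exists>d\<in>range (\<lambda>q::int. real n powi q). \<forall>x\<in>{real j / N..(real j + 1) / N}.
      G x = d * (x - real j / N) + G (real j / N)"
    proof (rule affine_on_break_free_interval)
      show "real j / N < (real j + 1) / N" using \<open>N > 0\<close> by (simp add: divide_strict_right_mono)
      show "continuous_on {real j / N..(real j + 1) / N} G" using cont continuous_on_subset by blast
      show "d \<in> range (\<lambda>q::int. real n powi q)" if "(G has_real_derivative d) (at x)" for x d
        using der lift that unfolding has_circle_derivative_def by blast
      fix x assume x: "x \<in> {real j / N<..<(real j + 1) / N}"
      then have jx: "real j < real N * x" "real N * x < real j + 1"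
        using \<open>N > 0\<close> by (auto simp: field_simps)
      have "real N * x \<notin> \<int>"
      proof
        assume "real N * x \<in> \<int>"
        then obtain i where "real N * x = of_int i" by (auto elim: Ints_cases)
        then have "real_of_int (int j) < of_int i" "of_int i < real_of_int (int j + 1)"
          using jx by simp_all
        then show False unfolding of_int_less_iff by simp
      qed
      then have "x \<notin> S" using N by blast
      moreover have "x \<in> {0..1}"
      proof -
        have "0 \<le> real N * x" "real N * x \<le> real N * 1" using jx \<open>j < N\<close> by linarith+
        then show ?thesis using \<open>N > 0\<close> by (simp add: zero_le_mult_iff)
      qed
      ultimately show "G differentiable (at x) \<and> isCont (deriv G) x" by (simp add: S_def)
    qed auto
    then show ?thesis by blast
  qed
  moreover have "G x \<in> \<rat>" if "x \<in> \<rat>" for x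
    using rat[of "to_circle x"] lift that by (simp add: is_lift_def flip: rational_points_iff)
  ultimately obtain M K where "grid_lift G M n K"
    using grid_lift_of_affine_pieces[OF \<open>circle_lift G\<close> \<open>n \<ge> 2\<close> \<open>N > 0\<close>] by blast
  then obtain I x z where "I > 0" "(G ^^ I) x = x + of_int z"
    using grid_lift.ex_periodic_point by blast
  from rot_lift_of_periodic_point[OF this] show ?thesis by simp
qed

theorem theoremA:
  fixes n :: nat and t :: "circle \<Rightarrow> circle"
  assumes "n > 0"
    and "t \<in> PL_plus"
    and "\<And>p. p \<in> rational_points \<Longrightarrow> t p \<in> rational_points"
    and "\<And>p. break_point t p \<Longrightarrow> p \<in> rational_points"
    and "\<And>p d. has_circle_derivative t d p \<Longrightarrow> \<exists>q::int. d = real n powi q"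
  shows "rotation_number t \<in> rational_points"
proof -
  have "\<exists>G. is_lift t G"
    using assms(2) by (auto simp: PL_plus_def orientation_preserving_homeo_def)
  then have lift: "is_lift t (SOME G. is_lift t G)" by (rule someI_ex)
  have "\<exists>n'\<ge>2. \<forall>p d. has_circle_derivative t d p \<longrightarrow> (\<exists>q::int. d = real n' powi q)"
  proof (cases "n = 1")
    case True
    \<comment> \<open>All derivatives are \<open>1 = 2\<^sup>0\<close>, so the base 2 serves as well.\<close>
    then have "d = real 2 powi 0" if "has_circle_derivative t d p" for p d
      using assms(5)[OF that] by simp
    then show ?thesis by blast
  next
    case False
    then show ?thesis using assms(1,5) by (intro exI[of _ n]) auto
  qed
  then obtain n' where "n' \<ge> 2"
    and "\<And>p d. has_circle_derivative t d p \<Longrightarrow> \<exists>q::int. d = real n' powi q" by blast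
  from rot_lift_rational[OF this(1) lift assms(2-4) this(2)]
  show ?thesis by (simp add: rotation_number_def rational_points_iff)
qed

end
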